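(* Let $(\alpha_{n,n+k})_{n\ge 0,\,k>0}$ be the rational numbers such that $\mathbf L=\exp(\mathbf l)$, where $\mathbf L$ and $\mathbf l$ are the operators defined in the context; write $\alpha_{ij}$ for $\alpha_{i,i+(j-i)}$ when $i<j$. Let $h=\operatorname{itlog}(e^z-1)\in z^2\mathbb Q[[z]]$ be the iterative logarithm of $e^z-1$, write $h=\sum_{n\ge 1}h_nz^n$ with $h_n\in\mathbb Q$, and define $c_n:=n!\,h_n$ for $n\ge 1$. Then $$\alpha_{ij}=c_{j-i+1}\binom{j+1}{i}\qquad\text{for all } i,j\in\mathbb N \text{ with } i<j,$$ and $$c_n=\sum_{\substack{1\le k<n\\ 1<n_1<\cdots<n_{k-1}<n_k=n}}\frac{(-1)^{k+1}}{k}{n_2\brace n_1}{n_3\brace n_2}\cdots{n_k\brace n_{k-1}}$$ for every $n\ge 1$.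
   Context: $\mathbb N=\{0,1,2,\dots\}$, and ${j\brace i}$ denotes the Stirling number of the second kind (the number of equivalence relations on a $j$-element set with exactly $i$ classes). In the formula for $c_n$ the sum is over all $k$ with $1\le k<n$ and all integers $n_1,\dots,n_k$ with $1<n_1<\cdots<n_{k-1}<n_k=n$; for $k=1$ the product of Stirling numbers is empty, hence $1$. **The operators (Shadrin–Zvonkine).** Let $K=\mathbb Q[z]$ and let $R=K[[t_0,t_1,\dots]]$, the ring of formal sums $\sum_{\boldsymbol i}f_{\boldsymbol i}t^{\boldsymbol i}$ with $f_{\boldsymbol i}\in K$, where $\boldsymbol i=(i_0,i_1,\dots)$ ranges over the finitely supported sequences in $\mathbb N$ and $t^{\boldsymbol i}=t_0^{i_0}t_1^{i_1}\cdots$. Put $\|\boldsymbol i\|=\sum_n (n+1)i_n$ and, for $f\in R$, $v(f)=\min\{\|\boldsymbol i\|: f_{\boldsymbol i}\ne 0\}$ ($v(0)=\infty$). Infinite sums in $R$ below are sums of summable families, computed coefficientwise. Let $\partial_n=\partial/\partial t_n$. Define rational numbers $a_{d,d+k}$ ($d,k\ge 0$) by the identity in $\mathbb Q[[\psi]]$ $$\sum_{b=1}^{d+1}\binom{d}{b-1}\frac{(-1)^{d-b+1}}{d!}\cdot\frac{1}{1-b\psi}=\sum_{k\ge 0}a_{d,d+k}\psi^{d+k}.$$ For $k>0$ define the $K$-linear map $L_k:R\to R$ by $$L_k=\sum_{\substack{0\le r\le k\\ k_1+\cdots+k_r=k\\ k_1,\dots,k_r>0\\ n_1,\dots,n_r\ge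 0}}\frac{1}{r!}\,a_{n_1,n_1+k_1}\cdots a_{n_r,n_r+k_r}\,t_{n_1+k_1}\cdots t_{n_r+k_r}\,\partial_{n_1}\cdots\partial_{n_r},$$ put $L_0=\mathrm{id}_R$, and $\mathbf L(f)=\sum_{k\ge0}z^kL_k(f)$ for $f\in R$ (well defined since $v(L_k(f))\ge k+v(f)$). For rational numbers $\alpha_{n,n+k}$ ($n\ge 0$, $k>0$) put $$l_k=\sum_n\alpha_{n,n+k}\,t_{n+k}\,\partial_n\quad(k>0),\qquad \mathbf l=\sum_{k>0}z^kl_k,$$ and $\exp(\mathbf l)(f)=\sum_{n\ge0}\frac1{n!}\mathbf l^n(f)$. It is a known result of Shadrin and Zvonkine that there are rational numbers $\alpha_{n,n+k}$ with $\mathbf L=\exp(\mathbf l)$, i.e. $\mathbf L(f)=\exp(\mathbf l)(f)$ for all $f\in R$; these are the numbers in the claim. **Iterative logarithm.** Matrices are indexed by $\mathbb N\times\mathbb N$. For $f\in z\mathbb Q[[z]]$, the iteration matrix $[f]=([f]_{ij})_{i,j\in\mathbb N}$ is the upper triangular matrix determined by $\frac{1}{i!}f^i=\sum_{j\ge0}[f]_{ij}\frac{z^j}{j!}$ for all $i$. For $h=\sum_{n\ge1}h_nz^n\in z\mathbb Q[[z]]$, the infinitesimal iteration matrix $\langle h\rangle$ is the upper triangular matrix with $\langle h\rangle_{0j}=0$ for all $j$, $\langle h\rangle_{ij}=\frac{j!}{(i-1)!}h_{j-i+1}$ for $1\le i\le j$, and $\langle h\rangle_{ij}=0$ for $i>j$.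 If $M$ is upper triangular with all diagonal entries $1$, then $\log(M)=\sum_{n\ge1}(-1)^{n+1}\frac{(M-1)^n}{n}$, where $1$ denotes the identity matrix (each entry of this sum is a finite sum). If $f\in z+z^2\mathbb Q[[z]]$, then there is a unique $h\in z^2\mathbb Q[[z]]$ with $\log[f]=\langle h\rangle$; this $h$ is the iterative logarithm $\operatorname{itlog}(f)$. (Equivalently, $h=\sum_{n\ge1}\frac{(-1)^{n-1}}{n}h[n]$ where $h[0]=z$ and $h[n+1]=h[n]\circ f-h[n]$.) *)

theory Defs
  imports
    "HOL-Library.Poly_Mapping"
    "HOL-Computational_Algebra.Computational_Algebra"
    "HOL-Combinatorics.Stirling"
begin

text \<open>
  An element of \<open>\<rat>[z][[t\<^sub>0, t\<^sub>1, \<dots>]]\<close> is given by its coefficients in \<open>\<rat>[z]\<close>, indexed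
  by the finitely supported exponent sequences. Only multiplication by scalars and by the
  variables is needed, so the general product of two series is not introduced.
\<close>

type_synonym series = "(nat \<Rightarrow>\<^sub>0 nat) \<Rightarrow> rat poly"

definition scale :: "rat poly \<Rightarrow> series \<Rightarrow> series" where
  "scale c f = (\<lambda>e. c * f e)"

definition times_var :: "nat \<Rightarrow> series \<Rightarrow> series" where
  "times_var n f = (\<lambda>e. if Poly_Mapping.lookup e n = 0 then 0
                        else f (e - Poly_Mapping.single n 1))"

definition partial :: "nat \<Rightarrow> series \<Rightarrow> series" where
  "partial n f = (\<lambda>e. of_nat (Poly_Mapping.lookup e n + 1) * f (e + Poly_Mapping.single n 1))"

text \<open>
  Sum of a family that is summable, i.e. for which every coefficient is nonzero for only finitely
  many members; \<^const>\<open>sum'\<close> sums over the indices with nonzero contribution.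
\<close>

definition series_sum :: "('i \<Rightarrow> series) \<Rightarrow> 'i set \<Rightarrow> series" where
  "series_sum F I = (\<lambda>e. sum' (\<lambda>i. F i e) I)"

text \<open>
  The coefficient of \<open>\<psi>\<^sup>j\<close> in the series with index \<open>d\<close>; only the coefficients with \<open>j \<ge> d\<close>
  are used below (those with \<open>j < d\<close> vanish).
\<close>

definition a_coeff :: "nat \<Rightarrow> nat \<Rightarrow> rat" where
  "a_coeff d j = fps_nth
     (\<Sum>b=1..d + 1. fps_const (of_nat (d choose (b - 1)) * (-1) ^ (d + 1 - b) / fact d)
                      * (1 / (1 - fps_const (of_nat b) * fps_X))) j"

text \<open>
  The list of pairs \<open>[(n\<^sub>1, k\<^sub>1), \<dots>, (n\<^sub>r, k\<^sub>r)]\<close> encodes one index of the sum defining \<open>L\<^sub>k\<close>.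
\<close>

definition L_indices :: "nat \<Rightarrow> (nat \<times> nat) list set" where
  "L_indices k = {ps. length ps \<le> k \<and> sum_list (map snd ps) = k \<and> (\<forall>(n, k') \<in> set ps. 0 < k')}"

definition L_term :: "(nat \<times> nat) list \<Rightarrow> series \<Rightarrow> series" where
  "L_term ps f =
     scale [: 1 / fact (length ps) * (\<Prod>(n, k')\<leftarrow>ps. a_coeff n (n + k')) :]
       (foldr (\<lambda>(n, k'). times_var (n + k')) ps (foldr (\<lambda>(n, k'). partial n) ps f))"

definition L_comp :: "nat \<Rightarrow> series \<Rightarrow> series" where
  "L_comp k f = (if k = 0 then f else series_sum (\<lambda>ps. L_term ps f) (L_indices k))"

definition L_op :: "series \<Rightarrow> series" where
  "L_op f = series_sum (\<lambda>k. scale (monom 1 k) (L_comp k f)) UNIV"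

definition l_comp :: "(nat \<Rightarrow> nat \<Rightarrow> rat) \<Rightarrow> nat \<Rightarrow> series \<Rightarrow> series" where
  "l_comp \<alpha> k f =
     series_sum (\<lambda>n. scale [: \<alpha> n (n + k) :] (times_var (n + k) (partial n f))) UNIV"

definition l_op :: "(nat \<Rightarrow> nat \<Rightarrow> rat) \<Rightarrow> series \<Rightarrow> series" where
  "l_op \<alpha> f = series_sum (\<lambda>k. scale (monom 1 k) (l_comp \<alpha> k f)) {0<..}"

definition exp_op :: "(series \<Rightarrow> series) \<Rightarrow> series \<Rightarrow> series" where
  "exp_op D f = series_sum (\<lambda>n. scale [: 1 / fact n :] ((D ^^ n) f)) UNIV"

type_synonym rmat = "nat \<Rightarrow> nat \<Rightarrow> rat"

definition mat_one :: rmat where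
  "mat_one i j = (if i = j then 1 else 0)"

text \<open>
  The product of upper triangular matrices: as \<open>N k j = 0\<close> for \<open>k > j\<close>, the sum stops at \<open>j\<close>.
\<close>

definition mat_mult :: "rmat \<Rightarrow> rmat \<Rightarrow> rmat" where
  "mat_mult M N i j = (\<Sum>k\<le>j. M i k * N k j)"

primrec mat_power :: "rmat \<Rightarrow> nat \<Rightarrow> rmat" where
  "mat_power M 0 = mat_one"
| "mat_power M (Suc n) = mat_mult M (mat_power M n)"

text \<open>For upper unitriangular \<open>M\<close>; then only finitely many terms of each entry are nonzero.\<close>

definition mat_log :: "rmat \<Rightarrow> rmat" where
  "mat_log M i j =
     sum' (\<lambda>n. (-1) ^ (n + 1) * mat_power (\<lambda>i j. M i j - mat_one i j) n i j / of_nat n) {1..}"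

definition iteration_matrix :: "rat fps \<Rightarrow> rmat" where
  "iteration_matrix f i j = fact j * fps_nth (fps_const (1 / fact i) * f ^ i) j"

definition inf_iteration_matrix :: "rat fps \<Rightarrow> rmat" where
  "inf_iteration_matrix h i j =
     (if 1 \<le> i \<and> i \<le> j then fact j / fact (i - 1) * fps_nth h (j - i + 1) else 0)"

definition itlog :: "rat fps \<Rightarrow> rat fps" where
  "itlog f = (THE h. fps_nth h 0 = 0 \<and> fps_nth h 1 = 0 \<and>
                     mat_log (iteration_matrix f) = inf_iteration_matrix h)"

text \<open>Sequences \<open>1 < n\<^sub>1 < \<dots> < n\<^sub>k = n\<close>; the entry \<open>n\<^sub>i\<close> is \<open>ns ! (i - 1)\<close>.\<close>

definition stirling_chains :: "nat \<Rightarrow> nat \<Rightarrow> nat list set" where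
  "stirling_chains n k = {ns. length ns = k \<and> sorted_wrt (<) (1 # ns) \<and> last ns = n}"

end

theory Submission
  imports Defs
begin

text \<open>
  On the coefficients of the variables \<open>t\<^sub>j\<close>, the operators \<open>L\<close> and \<open>l\<close> act, up to powers of \<open>z\<close>, by the
  matrices \<open>(a\<^sub>i\<^sub>j)\<close> and \<open>(\<alpha>\<^sub>i\<^sub>j)\<close>, so applying \<open>L = exp(l)\<close> to the variables gives
  \<open>(\<alpha>\<^sub>i\<^sub>j) = log (a\<^sub>i\<^sub>j)\<close>. The entry \<open>a\<^sub>i\<^sub>j\<close> is the Stirling number of \<open>j + 1\<close> and \<open>i + 1\<close>, that is, the
  matrix \<open>(a\<^sub>i\<^sub>j)\<close> is the iteration matrix of \<open>e\<^sup>z - 1\<close> without its first row and column. Hence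
  \<open>\<alpha>\<^sub>i\<^sub>j\<close> is the entry of \<open>log [e\<^sup>z - 1] = \<langle>h\<rangle>\<close> at \<open>(i + 1, j + 1)\<close>, while \<open>c\<^sub>n\<close> is the entry at
  \<open>(1, n)\<close>, which is computed by expanding the powers in the logarithm over chains of indices.
\<close>

subsection \<open>Power series of strictly upper triangular matrices\<close>

definition upper :: "rmat \<Rightarrow> bool" where
  "upper M \<longleftrightarrow> (\<forall>i j. j < i \<longrightarrow> M i j = 0)"

definition strictly_upper :: "rmat \<Rightarrow> bool" where
  "strictly_upper M \<longleftrightarrow> (\<forall>i j. j \<le> i \<longrightarrow> M i j = 0)"

lemma upperD: "upper M \<Longrightarrow> j < i \<Longrightarrow> M i j = 0"
  by (simp add: upper_def)

lemma strictly_upperD: "strictly_upper M \<Longrightarrow> j \<le> i \<Longrightarrow> M i j = 0"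
  by (simp add: strictly_upper_def)

lemma mat_mult_one_left: "upper N \<Longrightarrow> mat_mult mat_one N = N"
  by (intro ext) (auto simp: mat_mult_def mat_one_def if_distrib[of "\<lambda>x. x * _"] upper_def cong: if_cong)

lemma mat_mult_one_right [simp]: "mat_mult M mat_one = M"
  by (intro ext) (simp add: mat_mult_def mat_one_def if_distrib[of "\<lambda>x. _ * x"] cong: if_cong)

text \<open>The sum over \<open>l\<close> stops at \<open>k\<close> on the left and at
  \<open>j\<close> on the right; the entries \<open>N l k\<close> with l > k that make up the
  difference vanish.\<close>

lemma mat_mult_assoc:
  assumes "upper N"
  shows "mat_mult (mat_mult M N) P = mat_mult M (mat_mult N P)"
proof (intro ext)
  fix i j
  have "mat_mult (mat_mult M N) P i j = (\<Sum>k\<le>j. \<Sum>l\<le>k. M i l * N l k * P k j)"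
    by (simp add: mat_mult_def sum_distrib_right)
  also have "\<dots> = (\<Sum>k\<le>j. \<Sum>l\<le>j. M i l * N l k * P k j)"
    by (intro sum.cong refl sum.mono_neutral_left) (auto simp: upperD[OF assms])
  also have "\<dots> = (\<Sum>l\<le>j. \<Sum>k\<le>j. M i l * N l k * P k j)"
    by (rule sum.swap)
  also have "\<dots> = mat_mult M (mat_mult N P) i j"
    by (simp add: mat_mult_def sum_distrib_left mult.assoc)
  finally show "mat_mult (mat_mult M N) P i j = mat_mult M (mat_mult N P) i j" .
qed

lemma mat_power_eq_0:
  assumes "strictly_upper M" "j < i + n"
  shows "mat_power M n i j = 0"
  using assms(2)
proof (induction n arbitrary: i)
  case 0
  then show ?case by (simp add: mat_one_def)
next
  case (Suc n)
  have "M i k * mat_power M n k j = 0" for k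
    using Suc strictly_upperD[OF assms(1), of k i] by (cases "k \<le> i") auto
  then show ?case
    by (simp add: mat_mult_def del: mult_eq_0_iff)
qed

lemma upper_mat_power: "strictly_upper M \<Longrightarrow> upper (mat_power M n)"
  by (simp add: upper_def mat_power_eq_0)

lemma mat_power_add:
  assumes "strictly_upper M"
  shows "mat_power M (m + n) = mat_mult (mat_power M m) (mat_power M n)"
  by (induction m)
    (simp_all add: mat_mult_one_left mat_mult_assoc upper_mat_power assms)

text \<open>
  The value at \<open>A\<close> of a power series. The cutoff at \<open>j\<close> loses nothing when \<open>A\<close> is strictly upper
  triangular.
\<close>

definition mat_fps :: "rat fps \<Rightarrow> rmat \<Rightarrow> rmat" where
  "mat_fps \<phi> A i j = (\<Sum>k\<le>j. fps_nth \<phi> k * mat_power A k i j)"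

lemma mat_fps_atMost:
  assumes "strictly_upper A" "j \<le> N"
  shows "mat_fps \<phi> A i j = (\<Sum>k\<le>N. fps_nth \<phi> k * mat_power A k i j)"
  unfolding mat_fps_def
  by (rule sum.mono_neutral_left) (use assms in \<open>auto simp: mat_power_eq_0\<close>)

lemma strictly_upper_mat_fps:
  assumes "strictly_upper A" "fps_nth \<phi> 0 = 0"
  shows "strictly_upper (mat_fps \<phi> A)"
proof -
  have "fps_nth \<phi> k * mat_power A k i j = 0" if "j \<le> i" for i j k
    using assms that by (cases k) (auto simp: mat_power_eq_0 simp del: mat_power.simps)
  then show ?thesis
    by (simp add: strictly_upper_def mat_fps_def del: mult_eq_0_iff)
qed

lemma mat_fps_1: "mat_fps 1 A = mat_one"
  by (intro ext) (simp add: mat_fps_def if_distrib[of "\<lambda>x. x * _"] cong: if_cong)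

lemma mat_fps_X:
  assumes "strictly_upper A"
  shows "mat_fps fps_X A = A"
  by (intro ext)
    (auto simp: mat_fps_def fps_X_def if_distrib[of "\<lambda>x. x * _"] strictly_upperD[OF assms] cong: if_cong)

lemma mat_fps_add: "mat_fps (\<phi> + \<psi>) A i j = mat_fps \<phi> A i j + mat_fps \<psi> A i j"
  by (simp add: mat_fps_def sum.distrib algebra_simps)

lemma mat_fps_diff: "mat_fps (\<phi> - \<psi>) A i j = mat_fps \<phi> A i j - mat_fps \<psi> A i j"
  by (simp add: mat_fps_def sum_subtractf algebra_simps)

lemma mat_fps_mult:
  assumes A: "strictly_upper A"
  shows "mat_fps (\<phi> * \<psi>) A = mat_mult (mat_fps \<phi> A) (mat_fps \<psi> A)"
proof (intro ext)
  fix i j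
  let ?g = "\<lambda>m n. fps_nth \<phi> m * fps_nth \<psi> n * mat_power A (m + n) i j"
  have "mat_fps (\<phi> * \<psi>) A i j = (\<Sum>k\<le>j. \<Sum>m\<le>k. ?g m (k - m))"
    by (simp add: mat_fps_def fps_mult_nth sum_distrib_right atLeast0AtMost)
  also have "\<dots> = (\<Sum>(m, n)\<in>{(m, n). m + n \<le> j}. ?g m n)"
    by (rule sum.triangle_reindex_eq [symmetric])
  \<comment> \<open>\<open>mat_power A (m + n) i j\<close> vanishes for m + n > j, so the triangle
    can be filled up to a square.\<close>
  also have "\<dots> = (\<Sum>(m, n)\<in>{..j} \<times> {..j}. ?g m n)"
    by (rule sum.mono_neutral_left) (auto, metis A mat_power_eq_0 not_le trans_less_add2)
  also have "\<dots> = (\<Sum>m\<le>j. \<Sum>n\<le>j. ?g m n)"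
    by (simp add: sum.cartesian_product)
  also have "\<dots> = (\<Sum>m\<le>j. \<Sum>n\<le>j. \<Sum>k\<le>j.
      fps_nth \<phi> m * mat_power A m i k * (fps_nth \<psi> n * mat_power A n k j))"
    by (simp add: mat_power_add[OF A] mat_mult_def sum_distrib_left mult_ac)
  also have "\<dots> = (\<Sum>k\<le>j. \<Sum>m\<le>j. \<Sum>n\<le>j.
      fps_nth \<phi> m * mat_power A m i k * (fps_nth \<psi> n * mat_power A n k j))"
    by (subst (2) sum.swap, subst sum.swap) simp
  also have "\<dots> = (\<Sum>k\<le>j. (\<Sum>m\<le>j. fps_nth \<phi> m * mat_power A m i k) * mat_fps \<psi> A k j)"
    by (simp add: mat_fps_def sum_product)
  also have "\<dots> = mat_mult (mat_fps \<phi> A) (mat_fps \<psi> A) i j"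
    unfolding mat_mult_def by (intro sum.cong refl) (simp add: mat_fps_atMost[OF A, of _ j])
  finally show "mat_fps (\<phi> * \<psi>) A i j = mat_mult (mat_fps \<phi> A) (mat_fps \<psi> A) i j" .
qed

lemma mat_fps_power:
  assumes "strictly_upper A"
  shows "mat_fps (\<phi> ^ n) A = mat_power (mat_fps \<phi> A) n"
  by (induction n) (simp_all add: mat_fps_1 mat_fps_mult[OF assms])

text \<open>Carries identities between power series over to matrices. The truncated double sums
  agree because \<open>\<phi> ^ k\<close> has no terms of degree below k.\<close>

lemma mat_fps_compose:
  assumes A: "strictly_upper A" and \<phi>: "fps_nth \<phi> 0 = 0"
  shows "mat_fps (\<psi> oo \<phi>) A = mat_fps \<psi> (mat_fps \<phi> A)"
proof (intro ext)
  fix i j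
  have "mat_fps \<psi> (mat_fps \<phi> A) i j
      = (\<Sum>k\<le>j. \<Sum>m\<le>j. fps_nth \<psi> k * fps_nth (\<phi> ^ k) m * mat_power A m i j)"
    by (simp add: mat_fps_def mat_fps_power[OF A, symmetric] sum_distrib_left mult.assoc)
  also have "\<dots> = (\<Sum>m\<le>j. \<Sum>k\<le>j. fps_nth \<psi> k * fps_nth (\<phi> ^ k) m * mat_power A m i j)"
    by (rule sum.swap)
  also have "\<dots> = (\<Sum>m\<le>j. \<Sum>k\<le>m. fps_nth \<psi> k * fps_nth (\<phi> ^ k) m * mat_power A m i j)"
    by (intro sum.cong refl sum.mono_neutral_right) (auto simp: startsby_zero_power_prefix[OF \<phi>])
  also have "\<dots> = mat_fps (\<psi> oo \<phi>) A i j"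
    by (simp add: mat_fps_def fps_compose_nth sum_distrib_right atLeast0AtMost)
  finally show "mat_fps (\<psi> oo \<phi>) A i j = mat_fps \<psi> (mat_fps \<phi> A) i j" by simp
qed

section \<open>Matrix logarithm and exponential\<close>

lemma mat_log_eq_mat_fps:
  assumes "strictly_upper (\<lambda>i j. M i j - mat_one i j)"
  shows "mat_log M = mat_fps (fps_ln 1) (\<lambda>i j. M i j - mat_one i j)"
proof (intro ext)
  fix i j
  let ?N = "\<lambda>i j. M i j - mat_one i j"
  let ?t = "\<lambda>n. (-1) ^ (n + 1) * mat_power ?N n i j / of_nat n"
  have "mat_log M i j = sum' ?t {1..j}"
    unfolding mat_log_def
    by (rule sum.mono_neutral_right') (auto simp: mat_power_eq_0[OF assms])
  also have "\<dots> = (\<Sum>n=1..j. fps_nth (fps_ln 1) n * mat_power ?N n i j)"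
    by (auto simp: fps_ln_nth power_eq_if intro!: sum.cong)
  also have "\<dots> = mat_fps (fps_ln 1) ?N i j"
    unfolding mat_fps_def by (rule sum.mono_neutral_left) (auto simp: fps_ln_nth)
  finally show "mat_log M i j = mat_fps (fps_ln 1) ?N i j" .
qed

text \<open>Evaluates ln(1 + (e^X - 1)) = X at \<open>A\<close>; this is how \<alpha> is recovered
  from its exponential.\<close>

lemma mat_log_mat_fps_exp:
  assumes A: "strictly_upper A"
  shows "mat_log (mat_fps (fps_exp 1) A) = A"
proof -
  have E: "(\<lambda>i j. mat_fps (fps_exp 1) A i j - mat_one i j) = mat_fps (fps_exp 1 - 1) A"
    by (intro ext) (simp add: mat_fps_diff mat_fps_1)
  have "mat_log (mat_fps (fps_exp 1) A) = mat_fps (fps_ln 1 oo (fps_exp 1 - 1)) A"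
    using A by (subst mat_log_eq_mat_fps) (simp_all add: E strictly_upper_mat_fps mat_fps_compose)
  also have "fps_ln 1 oo (fps_exp 1 - 1) = (fps_X :: rat fps)"
    by (simp add: fps_ln_fps_exp_inv fps_inv)
  finally show ?thesis
    by (simp add: mat_fps_X[OF A])
qed

lemma mat_fps_exp_mat_log:
  assumes M: "strictly_upper (\<lambda>i j. M i j - mat_one i j)"
  shows "mat_fps (fps_exp 1) (mat_log M) = M"
proof -
  let ?N = "\<lambda>i j. M i j - mat_one i j"
  have "(fps_exp 1 - 1) oo fps_ln 1 = (fps_X :: rat fps)"
    by (simp add: fps_ln_fps_exp_inv fps_inv_right)
  then have "fps_exp 1 oo fps_ln 1 = (1 + fps_X :: rat fps)"
    by (simp add: fps_compose_sub_distrib algebra_simps)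
  then have "mat_fps (fps_exp 1) (mat_log M) = mat_fps (1 + fps_X) ?N"
    using M by (simp add: mat_log_eq_mat_fps flip: mat_fps_compose)
  then show ?thesis
    by (intro ext) (simp add: mat_fps_add mat_fps_1 mat_fps_X[OF M])
qed

lemma strictly_upper_mat_log:
  "strictly_upper (\<lambda>i j. M i j - mat_one i j) \<Longrightarrow> strictly_upper (mat_log M)"
  by (simp add: mat_log_eq_mat_fps strictly_upper_mat_fps)

subsection \<open>Linear parts of the operators\<close>

text \<open>The coefficients of the t_j in \<open>L_op f\<close> and \<open>l_op \<alpha> f\<close>
  depend only on those in \<open>f\<close>, which reduces both operators to matrices.\<close>

definition linear_coeff :: "series \<Rightarrow> nat \<Rightarrow> rat poly" where
  "linear_coeff f j = f (Poly_Mapping.single j 1)"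

lemma linear_coeff_scale [simp]: "linear_coeff (scale c f) j = c * linear_coeff f j"
  by (simp add: linear_coeff_def scale_def)

lemma linear_coeff_series_sum:
  "linear_coeff (series_sum F I) j = sum' (\<lambda>i. linear_coeff (F i) j) I"
  by (simp add: linear_coeff_def series_sum_def)

lemma linear_coeff_times_var: "linear_coeff (times_var n f) j = (if n = j then f 0 else 0)"
  by (auto simp: linear_coeff_def times_var_def lookup_single when_def)

lemma times_var_zero: "times_var n f 0 = 0"
  by (simp add: times_var_def)

lemma partial_zero: "partial n f 0 = linear_coeff f n"
  by (simp add: partial_def linear_coeff_def)

definition series_var :: "nat \<Rightarrow> series" where
  "series_var m = (\<lambda>e. if e = Poly_Mapping.single m 1 then 1 else 0)"

lemma linear_coeff_series_var: "linear_coeff (series_var m) j = (if j = m then 1 else 0)"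
proof -
  have "j = m" if "Poly_Mapping.single j 1 = Poly_Mapping.single m (1 :: nat)"
    using arg_cong[OF that, of "\<lambda>e. Poly_Mapping.lookup e j"]
    by (simp add: lookup_single when_def split: if_splits)
  then show ?thesis
    by (auto simp: linear_coeff_def series_var_def)
qed

text \<open>A product of two or more variables has no linear part, so only lists of length one reach
  t_j, and then n + k = j.\<close>

lemma linear_coeff_L_term:
  assumes "ps \<in> L_indices k" "0 < k"
  shows "linear_coeff (L_term ps f) j =
    (if k \<le> j \<and> ps = [(j - k, k)] then [:a_coeff (j - k) j:] * linear_coeff f (j - k) else 0)"
proof -
  consider "ps = []" | n k' where "ps = [(n, k')]" | n k' n' k'' qs where "ps = (n, k') # (n', k'') # qs"
    by (metis list.exhaust surj_pair)
  then show ?thesis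
  proof cases
    case 1
    with assms show ?thesis by (simp add: L_indices_def)
  next
    case 2
    with assms show ?thesis
      by (auto simp: L_indices_def L_term_def linear_coeff_times_var partial_zero)
  next
    case 3
    then show ?thesis
      by (simp add: L_term_def linear_coeff_times_var times_var_zero)
  qed
qed

lemma linear_coeff_L_comp:
  assumes "0 < k"
  shows "linear_coeff (L_comp k f) j =
    (if k \<le> j then [:a_coeff (j - k) j:] * linear_coeff f (j - k) else 0)"
proof -
  let ?I = "if k \<le> j then {[(j - k, k)]} else {}"
  have "linear_coeff (L_comp k f) j = sum' (\<lambda>ps. linear_coeff (L_term ps f) j) (L_indices k)"
    using assms by (simp add: L_comp_def linear_coeff_series_sum)
  also have "\<dots> = sum' (\<lambda>ps. linear_coeff (L_term ps f) j) ?I"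
    by (rule sum.mono_neutral_right') (use assms in \<open>auto simp: L_indices_def linear_coeff_L_term split: if_splits\<close>)
  also have "\<dots> = (if k \<le> j then [:a_coeff (j - k) j:] * linear_coeff f (j - k) else 0)"
    using assms by (simp add: L_indices_def linear_coeff_L_term[of _ k])
  finally show ?thesis .
qed

lemma linear_coeff_L_op_series_var:
  assumes "m < j"
  shows "linear_coeff (L_op (series_var m)) j = monom (a_coeff m j) (j - m)"
proof -
  have "monom 1 k * linear_coeff (L_comp k (series_var m)) j
      = (if k = j - m then monom (a_coeff m j) (j - m) else 0)" for k
  proof (cases "k = 0")
    \<comment> \<open>Since m < j, the identity \<open>L_comp 0\<close> contributes nothing at
      t_j.\<close>
    case True
    then show ?thesis
      using assms by (simp add: L_comp_def linear_coeff_series_var)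
  next
    case False
    then show ?thesis
      using assms by (auto simp: linear_coeff_L_comp linear_coeff_series_var smult_monom)
  qed
  then have "linear_coeff (L_op (series_var m)) j
      = sum' (\<lambda>k. if k = j - m then monom (a_coeff m j) (j - m) else 0) UNIV"
    by (simp add: L_op_def linear_coeff_series_sum)
  also have "\<dots> = sum' (\<lambda>k. if k = j - m then monom (a_coeff m j) (j - m) else 0) {j - m}"
    by (rule sum.mono_neutral_right') auto
  finally show ?thesis by simp
qed

text \<open>\<open>l_op\<close> reads \<alpha> only at i < j; filling up with zeros gives a matrix
  to which power series can be applied.\<close>

definition strict_part :: "rmat \<Rightarrow> rmat" where
  "strict_part M i j = (if i < j then M i j else 0)"

lemma strictly_upper_strict_part: "strictly_upper (strict_part M)"
  by (simp add: strictly_upper_def strict_part_def)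

lemma linear_coeff_l_comp:
  "linear_coeff (l_comp \<alpha> k f) j =
    (if k \<le> j then [:\<alpha> (j - k) j:] * linear_coeff f (j - k) else 0)"
proof -
  let ?t = "\<lambda>n. [:\<alpha> n (n + k):] * (if n + k = j then linear_coeff f n else 0)"
  have "linear_coeff (l_comp \<alpha> k f) j = sum' ?t UNIV"
    by (simp add: l_comp_def linear_coeff_series_sum linear_coeff_times_var partial_zero
        cong: if_cong)
  also have "\<dots> = sum' ?t (if k \<le> j then {j - k} else {})"
    by (rule sum.mono_neutral_right') auto
  finally show ?thesis by simp
qed

lemma linear_coeff_l_op:
  "linear_coeff (l_op \<alpha> f) j =
    (\<Sum>i\<le>j. monom (strict_part \<alpha> i j) (j - i) * linear_coeff f i)"
proof -
  let ?t = "\<lambda>k. monom 1 k * linear_coeff (l_comp \<alpha> k f) j"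
  have "linear_coeff (l_op \<alpha> f) j = sum' ?t {0<..}"
    by (simp add: l_op_def linear_coeff_series_sum)
  also have "\<dots> = sum' ?t {0<..j}"
    by (rule sum.mono_neutral_right') (auto simp: linear_coeff_l_comp)
  also have "\<dots> = (\<Sum>k\<in>{0<..j}. monom (strict_part \<alpha> (j - k) j) k * linear_coeff f (j - k))"
    by (auto simp: linear_coeff_l_comp strict_part_def smult_monom mult_smult_right
        simp flip: mult_smult_left intro!: sum.cong)
  also have "\<dots> = (\<Sum>i<j. monom (strict_part \<alpha> i j) (j - i) * linear_coeff f i)"
    by (rule sum.reindex_bij_witness[of _ "\<lambda>i. j - i" "\<lambda>k. j - k"]) auto
  \<comment> \<open>The added term i = j is zero; the range is now that of
    \<open>mat_mult\<close>.\<close>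
  also have "\<dots> = (\<Sum>i\<le>j. monom (strict_part \<alpha> i j) (j - i) * linear_coeff f i)"
    by (simp add: strict_part_def flip: lessThan_Suc_atMost)
  finally show ?thesis .
qed

text \<open>The exponents j - i and i - m add up to j - m, so the power of z factors out and a plain
  matrix power remains.\<close>

lemma linear_coeff_l_op_funpow:
  "linear_coeff ((l_op \<alpha> ^^ n) (series_var m)) j =
    monom (mat_power (strict_part \<alpha>) n m j) (j - m)"
proof (induction n arbitrary: j)
  case 0
  then show ?case by (simp add: linear_coeff_series_var mat_one_def)
next
  case (Suc n)
  let ?P = "mat_power (strict_part \<alpha>)"
  have "linear_coeff ((l_op \<alpha> ^^ Suc n) (series_var m)) j
      = (\<Sum>i\<le>j. monom (strict_part \<alpha> i j) (j - i) * monom (?P n m i) (i - m))"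
    by (simp add: linear_coeff_l_op Suc)
  also have "\<dots> = (\<Sum>i\<le>j. monom (?P n m i * strict_part \<alpha> i j) (j - m))"
  proof (intro sum.cong refl)
    fix i assume "i \<in> {..j}"
    then show "monom (strict_part \<alpha> i j) (j - i) * monom (?P n m i) (i - m)
        = monom (?P n m i * strict_part \<alpha> i j) (j - m)"
      \<comment> \<open>For i < m the truncated difference i - m gives a wrong exponent, but then
        the matrix entry is zero.\<close>
      using mat_power_eq_0[OF strictly_upper_strict_part, of i m n]
      by (cases "m \<le> i") (auto simp: mult_monom mult.commute)
  qed
  also have "\<dots> = monom (mat_mult (?P n) (strict_part \<alpha>) m j) (j - m)"
    by (simp add: mat_mult_def monom_sum)
  \<comment> \<open>The operator adds a factor on the right, \<open>mat_power\<close> on the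
    left.\<close>
  also have "mat_mult (?P n) (strict_part \<alpha>) = ?P (Suc n)"
    using mat_power_add[OF strictly_upper_strict_part, of \<alpha> n 1] by simp
  finally show ?case .
qed

lemma linear_coeff_exp_op_series_var:
  "linear_coeff (exp_op (l_op \<alpha>) (series_var m)) j =
    monom (mat_fps (fps_exp 1) (strict_part \<alpha>) m j) (j - m)"
proof -
  let ?t = "\<lambda>n. monom (1 / fact n * mat_power (strict_part \<alpha>) n m j) (j - m)"
  have "linear_coeff (exp_op (l_op \<alpha>) (series_var m)) j = sum' ?t UNIV"
    by (simp add: exp_op_def linear_coeff_series_sum linear_coeff_l_op_funpow smult_monom)
  also have "\<dots> = sum' ?t {..j}"
    by (rule sum.mono_neutral_right') (auto simp: mat_power_eq_0[OF strictly_upper_strict_part])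
  finally show ?thesis
    by (simp add: mat_fps_def monom_sum)
qed

text \<open>Compares the coefficients of t_j in L(t_m) = exp(l)(t_m), both of them multiples of
  z^(j-m).\<close>

lemma a_coeff_eq_exp:
  assumes "\<And>f. L_op f = exp_op (l_op \<alpha>) f" "m < j"
  shows "a_coeff m j = mat_fps (fps_exp 1) (strict_part \<alpha>) m j"
proof -
  have "monom (a_coeff m j) (j - m) = monom (mat_fps (fps_exp 1) (strict_part \<alpha>) m j) (j - m)"
    unfolding linear_coeff_L_op_series_var[OF assms(2), symmetric] assms(1)
    by (rule linear_coeff_exp_op_series_var)
  then show ?thesis by simp
qed

subsection \<open>The iteration matrix of the shifted exponential series\<close>

text \<open>Read off from the derivative (i+1) (e^z - 1)^i e^z of (e^z - 1)^(i+1).\<close>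

lemma iteration_matrix_exp_Suc_Suc:
  "iteration_matrix (fps_exp 1 - 1) (Suc i) (Suc j) =
    fact j / fact i * fps_nth ((fps_exp 1 - 1) ^ i * fps_exp 1) j"
proof -
  have "fps_deriv ((fps_exp 1 - 1) ^ Suc i)
      = fps_const (of_nat (Suc i)) * ((fps_exp 1 - 1) ^ i * fps_exp 1 :: rat fps)"
    by (subst fps_deriv_power) (simp add: mult_ac del: of_nat_Suc)
  then have "of_nat (Suc j) * fps_nth ((fps_exp 1 - 1) ^ Suc i) (Suc j)
      = of_nat (Suc i) * fps_nth ((fps_exp 1 - 1) ^ i * fps_exp 1 :: rat fps) j"
    by (metis Suc_eq_plus1 fps_deriv_nth fps_mult_left_const_nth)
  then show ?thesis
    by (simp add: iteration_matrix_def field_simps del: power_Suc of_nat_Suc)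
qed

text \<open>Writing e^z = (e^z - 1) + 1 in the preceding formula yields the Stirling
  recurrence.\<close>

lemma iteration_matrix_exp:
  "iteration_matrix (fps_exp 1 - 1) i j = of_nat (Stirling j i)"
proof (induction j i rule: Stirling.induct)
  case (4 n k)
  have "(fps_exp 1 - 1) ^ k * fps_exp 1 = (fps_exp 1 - 1) ^ Suc k + (fps_exp 1 - 1 :: rat fps) ^ k"
    by (simp add: algebra_simps)
  then have "iteration_matrix (fps_exp 1 - 1) (Suc k) (Suc n)
      = of_nat (Suc k) * iteration_matrix (fps_exp 1 - 1) (Suc k) n + iteration_matrix (fps_exp 1 - 1) k n"
    unfolding iteration_matrix_exp_Suc_Suc
    by (simp add: iteration_matrix_def field_simps del: power_Suc of_nat_Suc)
  with 4 show ?case by (simp add: algebra_simps)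
qed (simp_all add: iteration_matrix_def)

lemma fps_nth_geometric:
  fixes c :: "'a :: field"
  shows "fps_nth (1 / (1 - fps_const c * fps_X)) n = c ^ n"
proof -
  have "(1 - fps_const c * fps_X) * Abs_fps (\<lambda>n. c ^ n) = 1"
  proof (rule fps_ext)
    fix n show "fps_nth ((1 - fps_const c * fps_X) * Abs_fps (\<lambda>n. c ^ n)) n = fps_nth 1 n"
      by (cases n) (simp_all add: left_diff_distrib mult.assoc)
  qed
  then have "inverse (1 - fps_const c * fps_X) = Abs_fps (\<lambda>n. c ^ n)"
    by (rule fps_inverse_unique)
  then show ?thesis
    by (simp add: fps_divide_unit)
qed

text \<open>
  Both sides are coefficients of the derivative \<open>(e\<^sup>z - 1)\<^sup>d e\<^sup>z / d!\<close> of \<open>(e\<^sup>z - 1)\<^sup>d\<^sup>+\<^sup>1 / (d + 1)!\<close>,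
  on the left after a binomial expansion.
\<close>

lemma a_coeff_eq_Stirling: "a_coeff d j = of_nat (Stirling (Suc j) (Suc d))"
proof -
  \<comment> \<open>The k-th term of the binomial expansion of (e^z - 1)^d, times e^z; its
    exponentials combine to e^((k+1)z).\<close>
  let ?t = "\<lambda>k. of_nat (d choose k) * fps_exp 1 ^ k * (-1) ^ (d - k) * fps_exp 1 :: rat fps"
  have nth: "fps_nth (?t k) j = of_nat (d choose k) * (-1) ^ (d - k) * of_nat (Suc k) ^ j / fact j" for k
  proof -
    have "fps_exp 1 ^ Suc k = (fps_exp (of_nat (Suc k)) :: rat fps)"
      by (simp only: fps_exp_power_mult mult_1_right)
    then have "?t k = of_nat (d choose k) * (-1) ^ (d - k) * fps_exp (of_nat (Suc k))"
      by (simp add: mult_ac del: of_nat_Suc)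
    also have "of_nat (d choose k) * (-1) ^ (d - k) = fps_const (of_nat (d choose k) * (-1) ^ (d - k) :: rat)"
      by (simp add: fps_of_nat flip: fps_const_mult fps_const_power fps_const_neg)
    finally show ?thesis by (simp del: of_nat_Suc)
  qed
  have "a_coeff d j = (\<Sum>b=1..d + 1. of_nat (d choose (b - 1)) * (-1) ^ (d + 1 - b) / fact d * of_nat b ^ j)"
    by (simp only: a_coeff_def fps_sum_nth fps_mult_left_const_nth fps_nth_geometric)
  also have "\<dots> = (\<Sum>k\<le>d. of_nat (d choose k) * (-1) ^ (d - k) / fact d * of_nat (Suc k) ^ j)"
    by (rule sum.reindex_bij_witness[of _ Suc "\<lambda>b. b - 1"]) auto
  also have "\<dots> = fact j / fact d * fps_nth (\<Sum>k\<le>d. ?t k) j"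
    unfolding fps_sum_nth nth by (simp add: sum_distrib_left del: of_nat_Suc)
  also have "(\<Sum>k\<le>d. ?t k) = (fps_exp 1 - 1) ^ d * fps_exp 1"
    using binomial_ring[of "fps_exp 1 :: rat fps" "-1" d] by (simp add: sum_distrib_right)
  also have "fact j / fact d * fps_nth \<dots> j = iteration_matrix (fps_exp 1 - 1) (Suc d) (Suc j)"
    by (rule iteration_matrix_exp_Suc_Suc [symmetric])
  finally show ?thesis
    by (simp add: iteration_matrix_exp)
qed

subsection \<open>The iterative logarithm\<close>

lemma iteration_matrix_X: "iteration_matrix fps_X = mat_one"
  by (intro ext) (simp add: iteration_matrix_def mat_one_def)

lemma iteration_matrix_0: "iteration_matrix f 0 = mat_one 0"
  by (intro ext) (simp add: iteration_matrix_def mat_one_def)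

text \<open>Substituting g for z in f^i / i! = sum of [f]_ik z^k / k! expresses the result through
  the g^k / k!, the generating series of the rows of [g].\<close>

lemma iteration_matrix_compose:
  assumes "fps_nth g 0 = 0"
  shows "iteration_matrix (f oo g) = mat_mult (iteration_matrix f) (iteration_matrix g)"
proof (intro ext)
  fix i j
  have "fps_const (1 / fact i) * (f oo g) ^ i = (fps_const (1 / fact i) * f ^ i) oo g"
    using assms by (simp add: fps_compose_mult_distrib fps_compose_power)
  then show "iteration_matrix (f oo g) i j = mat_mult (iteration_matrix f) (iteration_matrix g) i j"
    by (simp add: iteration_matrix_def mat_mult_def fps_compose_nth sum_distrib_left atLeast0AtMost
        mult_ac)
qed

lemma mat_power_iteration_matrix:
  assumes "fps_nth f 0 = 0"
  shows "mat_power (iteration_matrix f) n = iteration_matrix (((\<lambda>g. f oo g) ^^ n) fps_X)"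
proof (induction n)
  case (Suc n)
  have "fps_nth (((\<lambda>g. f oo g) ^^ n) fps_X) 0 = 0"
    by (induction n) (simp_all add: assms)
  then show ?case
    by (simp add: Suc iteration_matrix_compose)
qed (simp add: iteration_matrix_X)

text \<open>The rows of \<open>[f]\<close> are determined by the first one, because \<open>f\<^sup>i\<^sup>+\<^sup>1 = f\<^sup>i f\<close>.\<close>

lemma iteration_matrix_Suc:
  "of_nat (Suc i) * iteration_matrix f (Suc i) j =
    (\<Sum>l\<le>j. of_nat (j choose l) * (iteration_matrix f i l * iteration_matrix f 1 (j - l)))"
proof -
  have "of_nat (Suc i) * iteration_matrix f (Suc i) j = fact j / fact i * fps_nth (f ^ i * f) j"
    by (simp add: iteration_matrix_def mult.commute del: of_nat_Suc)
  also have "\<dots> = (\<Sum>l\<le>j. fact j / fact i * (fps_nth (f ^ i) l * fps_nth f (j - l)))"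
    by (simp add: fps_mult_nth sum_distrib_left atLeast0AtMost)
  also have "\<dots> = (\<Sum>l\<le>j. of_nat (j choose l) * (iteration_matrix f i l * iteration_matrix f 1 (j - l)))"
    by (intro sum.cong refl) (simp add: iteration_matrix_def binomial_fact)
  finally show ?thesis .
qed

lemma strictly_upper_iteration_matrix:
  assumes "fps_nth f 0 = 0" "fps_nth f 1 = 1"
  shows "strictly_upper (\<lambda>i j. iteration_matrix f i j - mat_one i j)"
  using assms startsby_zero_power_prefix[OF assms(1)] startsby_zero_power_nth_same[OF assms(1)]
  by (auto simp: strictly_upper_def iteration_matrix_def mat_one_def le_less)

text \<open>In characteristic zero the naturals provide infinitely many roots of p - q.\<close>

lemma poly_eqI_of_nat:
  fixes p q :: "'a :: {idom, ring_char_0} poly"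
  assumes "\<And>n. poly p (of_nat n) = poly q (of_nat n)"
  shows "p = q"
proof (rule ccontr)
  assume "p \<noteq> q"
  then have "finite {x. poly (p - q) x = 0}"
    by (intro poly_roots_finite) simp
  moreover have "range of_nat \<subseteq> {x. poly (p - q) x = 0}"
    using assms by auto
  ultimately show False
    using infinite_UNIV_char_0 finite_imageD[OF finite_subset inj_of_nat] by blast
qed

text \<open>
  The entries of \<open>[f]\<^sup>n = exp (n log [f])\<close> are polynomials in \<open>n\<close> with linear coefficient \<open>log [f]\<close>.
  As \<open>[f]\<^sup>n\<close> is an iteration matrix for every \<open>n\<close>, the relation between its rows is an identity of
  polynomials, and its linear coefficient relates the rows of \<open>log [f]\<close>.
\<close>

lemma mat_log_iteration_matrix_Suc:
  assumes f: "fps_nth f 0 = 0" "fps_nth f 1 = 1" and j: "j > 0"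
  defines "D \<equiv> mat_log (iteration_matrix f)"
  shows "D 0 j = 0"
    and "i \<le> j \<Longrightarrow> of_nat (Suc i) * D (Suc i) j =
           of_nat (j choose i) * D 1 (j - i) + of_nat j * D i (j - 1)"
proof -
  \<comment> \<open>\<open>q i j\<close> is the entry of exp(x D) as a polynomial in x;
    \<open>F n\<close> is the n-th iterate of f.\<close>
  define q where "q = (\<lambda>i j. \<Sum>k\<le>j. monom (mat_power D k i j / fact k) k)"
  define F where "F n = ((\<lambda>g. f oo g) ^^ n) fps_X" for n
  note N = strictly_upper_iteration_matrix[OF f]
  have D: "strictly_upper D"
    unfolding D_def by (rule strictly_upper_mat_log[OF N])
  have poly_q: "poly (q i j) (of_nat n) = iteration_matrix (F n) i j" for i j n
  proof -
    have "iteration_matrix (F n) = mat_power (mat_fps (fps_exp 1) D) n"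
      unfolding F_def D_def by (simp add: mat_power_iteration_matrix f mat_fps_exp_mat_log[OF N])
    also have "\<dots> = mat_fps (fps_exp (of_nat n)) D"
      by (simp add: fps_exp_power_mult flip: mat_fps_power[OF D])
    finally show ?thesis
      by (simp add: q_def poly_sum poly_monom mat_fps_def mult.commute)
  qed
  have q0: "coeff (q i j) 0 = mat_one i j" for i j
    by (simp add: q_def coeff_sum)
  \<comment> \<open>For j = 0 the truncated sum has no linear term, in agreement with D i 0 =
    0.\<close>
  have q1: "coeff (q i j) 1 = D i j" for i j
    using strictly_upperD[OF D] by (auto simp: q_def coeff_sum)
  have "q 0 j = [:mat_one 0 j:]"
    by (rule poly_eqI_of_nat) (simp add: poly_q iteration_matrix_0)
  then show "D 0 j = 0"
    by (simp flip: q1)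
  have "smult (of_nat (Suc i)) (q (Suc i) j) = (\<Sum>l\<le>j. smult (of_nat (j choose l)) (q i l * q 1 (j - l)))" for i
    by (rule poly_eqI_of_nat)
      (simp add: poly_q poly_sum iteration_matrix_Suc[unfolded One_nat_def] del: of_nat_Suc)
  then have "coeff (smult (of_nat (Suc i)) (q (Suc i) j)) 1
      = coeff (\<Sum>l\<le>j. smult (of_nat (j choose l)) (q i l * q 1 (j - l))) 1" for i
    by (rule arg_cong)
  \<comment> \<open>A Leibniz rule at x = 0, where exp(x D) is the identity.\<close>
  moreover have "coeff (q i l * q i' l') 1 = mat_one i l * D i' l' + D i l * mat_one i' l'" for i l i' l'
    by (simp add: coeff_mult q0 q1[unfolded One_nat_def])
  ultimately have "of_nat (Suc i) * D (Suc i) j =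
      (\<Sum>l\<le>j. of_nat (j choose l) * (mat_one i l * D 1 (j - l) + D i l * mat_one 1 (j - l)))" for i
    by (simp only: coeff_smult coeff_sum q1)
  \<comment> \<open>The two Kronecker deltas select l = i and j - l = 1; the latter means l = j - 1
    only because j > 0.\<close>
  moreover have "of_nat (j choose l) * (mat_one i l * D 1 (j - l) + D i l * mat_one 1 (j - l))
      = (if l = i then of_nat (j choose l) * D 1 (j - l) else 0)
        + (if l = j - 1 then of_nat (j choose l) * D i l else 0)" if "l \<le> j" for i l
    using that j by (auto simp: mat_one_def distrib_left)
  ultimately have "of_nat (Suc i) * D (Suc i) j = (\<Sum>l\<le>j. if l = i then of_nat (j choose l) * D 1 (j - l) else 0)
      + (\<Sum>l\<le>j. if l = j - 1 then of_nat (j choose l) * D i l else 0)" for i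
    by (simp add: sum.distrib del: of_nat_Suc)
  then show "i \<le> j \<Longrightarrow> of_nat (Suc i) * D (Suc i) j =
           of_nat (j choose i) * D 1 (j - i) + of_nat j * D i (j - 1)"
    using j by (cases j) (simp_all del: of_nat_Suc)
qed

text \<open>Solves the recursion row by row: with h_n = D 1 n / n!, its two summands are 1 and i
  times j!/i! h_(j-i), so the factor i + 1 cancels.\<close>

lemma mat_log_iteration_matrix:
  assumes f: "fps_nth f 0 = 0" "fps_nth f 1 = 1"
  shows "mat_log (iteration_matrix f) =
    inf_iteration_matrix (Abs_fps (\<lambda>n. mat_log (iteration_matrix f) 1 n / fact n))"
proof (intro ext)
  fix i j
  define D where "D = mat_log (iteration_matrix f)"
  have D: "strictly_upper D"
    unfolding D_def by (intro strictly_upper_mat_log strictly_upper_iteration_matrix f)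
  note rec = mat_log_iteration_matrix_Suc[OF f, folded D_def]
  have "D i j = (if 1 \<le> i \<and> i \<le> j then fact j / fact (i - 1) * (D 1 (j - i + 1) / fact (j - i + 1)) else 0)"
  proof (induction i arbitrary: j)
    case 0
    then show ?case
      using rec(1)[of j] strictly_upperD[OF D, of 0 0] by (cases j) auto
  next
    case (Suc i)
    show ?case
    proof (cases "Suc i \<le> j")
      case True
      note IH = Suc.IH
      from True obtain d where d: "j = Suc (i + d)"
        by (auto simp: le_iff_add)
      have "of_nat (Suc i) * D (Suc i) j = of_nat (j choose i) * D 1 (j - i) + of_nat j * D i (j - 1)"
        using True by (intro rec) auto
      \<comment> \<open>Row 0 of \<open>D\<close> vanishes, and so does the factor i on the right;
        for i > 0 the induction hypothesis applies in column j - 1.\<close>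
      also have "of_nat j * D i (j - 1) = fact j * of_nat i / fact i * (D 1 (j - i) / fact (j - i))"
      proof (cases i)
        case 0
        with rec(1)[of "j - 1"] strictly_upperD[OF D, of 0 0] show ?thesis by (cases "j - 1") auto
      next
        case (Suc i')
        have "D i (j - 1) = fact (j - 1) / fact i' * (D 1 (j - i) / fact (j - i))"
          using IH[of "j - 1"] Suc d by simp
        moreover have "fact j = (of_nat j * fact (j - 1) :: rat)" "fact i = (of_nat i * fact i' :: rat)"
          using Suc d by simp_all
        ultimately show ?thesis
          using Suc by (simp del: of_nat_Suc fact_Suc)
      qed
      also have "of_nat (j choose i) * D 1 (j - i) + \<dots>
          = of_nat (Suc i) * (fact j / fact i * (D 1 (j - i) / fact (j - i)))"
        using True by (simp add: binomial_fact field_simps)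
      finally have "D (Suc i) j = fact j / fact i * (D 1 (j - i) / fact (j - i))"
        unfolding mult_cancel_left by (simp del: of_nat_Suc)
      then show ?thesis
        using True d by simp
    qed (use strictly_upperD[OF D] in auto)
  qed
  then show "mat_log (iteration_matrix f) i j =
      inf_iteration_matrix (Abs_fps (\<lambda>n. mat_log (iteration_matrix f) 1 n / fact n)) i j"
    by (simp add: inf_iteration_matrix_def D_def)
qed

text \<open>Row 1 of <h> consists of the numbers n! h_n for n > 0, so the h found above is the only
  candidate for the definite description.\<close>

lemma itlog:
  assumes f: "fps_nth f 0 = 0" "fps_nth f 1 = 1"
  shows "fps_nth (itlog f) 1 = 0"
    and "mat_log (iteration_matrix f) = inf_iteration_matrix (itlog f)"
proof -
  define h where "h = Abs_fps (\<lambda>n. mat_log (iteration_matrix f) 1 n / fact n)"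
  have log: "mat_log (iteration_matrix f) = inf_iteration_matrix h"
    unfolding h_def by (rule mat_log_iteration_matrix[OF f])
  have "strictly_upper (mat_log (iteration_matrix f))"
    by (intro strictly_upper_mat_log strictly_upper_iteration_matrix f)
  then have h: "fps_nth h 0 = 0" "fps_nth h 1 = 0"
    by (auto simp: h_def strictly_upper_def)
  have "itlog f = h"
    unfolding itlog_def
  proof (rule the_equality)
    fix g assume g: "fps_nth g 0 = 0 \<and> fps_nth g 1 = 0 \<and>
      mat_log (iteration_matrix f) = inf_iteration_matrix g"
    show "g = h"
    proof (rule fps_ext)
      fix n
      have "inf_iteration_matrix g 1 n = inf_iteration_matrix h 1 n"
        using g log by simp
      then show "fps_nth g n = fps_nth h n"
        using g h by (cases n) (auto simp: inf_iteration_matrix_def)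
    qed
  qed (use h log in simp)
  with h log show "fps_nth (itlog f) 1 = 0"
    "mat_log (iteration_matrix f) = inf_iteration_matrix (itlog f)" by simp_all
qed

subsection \<open>Matrix powers as sums over chains\<close>

text \<open>The start \<open>i\<close> varies in inductions on the length. With
  \<open>last (i # ns)\<close> the empty chain ends at \<open>i\<close>, matching the identity
  matrix.\<close>

definition strict_chains :: "nat \<Rightarrow> nat \<Rightarrow> nat \<Rightarrow> nat list set" where
  "strict_chains i n k = {ns. length ns = k \<and> sorted_wrt (<) (i # ns) \<and> last (i # ns) = n}"

lemma strict_chains_0: "strict_chains i n 0 = (if i = n then {[]} else {})"
  by (auto simp: strict_chains_def)

lemma strict_chains_Suc: "strict_chains i n (Suc k) = (\<Union>m\<in>{i<..n}. (#) m ` strict_chains m n k)"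
proof -
  \<comment> \<open>This bounds the first entry m of a chain by its end n.\<close>
  have "hd (m # ns) \<le> last (m # ns)" if "sorted_wrt (<) (m # ns)" for m :: nat and ns
    using that by (cases ns rule: rev_cases) auto
  then show ?thesis
    by (fastforce simp: strict_chains_def length_Suc_conv)
qed

lemma finite_strict_chains: "finite (strict_chains i n k)"
  by (induction k arbitrary: i) (simp_all add: strict_chains_0 strict_chains_Suc)

text \<open>In the expansion of the product only strictly increasing index paths survive; the
  induction splits off their first step.\<close>

lemma mat_power_strict_chains:
  assumes "strictly_upper M"
  shows "mat_power M k i n = (\<Sum>ns\<in>strict_chains i n k. \<Prod>l<k. M ((i # ns) ! l) (ns ! l))"
proof (induction k arbitrary: i)
  case 0
  then show ?case by (simp add: strict_chains_0 mat_one_def)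
next
  case (Suc k)
  have "(\<Sum>ns\<in>strict_chains i n (Suc k). \<Prod>l<Suc k. M ((i # ns) ! l) (ns ! l))
      = (\<Sum>m\<in>{i<..n}. \<Sum>ns\<in>(#) m ` strict_chains m n k. \<Prod>l<Suc k. M ((i # ns) ! l) (ns ! l))"
    unfolding strict_chains_Suc by (rule sum.UNION_disjoint) (auto simp: finite_strict_chains)
  also have "\<dots> = (\<Sum>m\<in>{i<..n}. M i m * mat_power M k m n)"
    by (simp add: sum.reindex prod.lessThan_Suc_shift Suc sum_distrib_left del: prod.lessThan_Suc)
  also have "\<dots> = (\<Sum>m\<le>n. M i m * mat_power M k m n)"
    by (rule sum.mono_neutral_left) (use strictly_upperD[OF assms] in auto)
  finally show ?case
    by (simp add: mat_mult_def)
qed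

text \<open>For k = 0 the left side would involve \<open>last []\<close>, which has no specified
  value.\<close>

lemma stirling_chains_eq_strict_chains: "k > 0 \<Longrightarrow> stirling_chains n k = strict_chains 1 n k"
  by (auto simp: stirling_chains_def strict_chains_def)

lemma mat_power_iteration_matrix_exp:
  assumes "k > 0"
  defines "N \<equiv> \<lambda>i j. iteration_matrix (fps_exp 1 - 1) i j - mat_one i j"
  shows "mat_power N k 1 n =
    (\<Sum>ns\<in>stirling_chains n k. \<Prod>i<k - 1. of_nat (Stirling (ns ! (i + 1)) (ns ! i)))"
proof -
  have N: "N i j = of_nat (Stirling j i)" if "i < j" for i j
    using that by (simp add: N_def iteration_matrix_exp mat_one_def)
  have prod: "(\<Prod>l<k. N ((1 # ns) ! l) (ns ! l)) = (\<Prod>i<k - 1. of_nat (Stirling (ns ! (i + 1)) (ns ! i)))"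
    if "ns \<in> stirling_chains n k" for ns
  proof -
    from assms obtain k' where k: "k = Suc k'"
      by (cases k) auto
    have ns: "length ns = k" "sorted_wrt (<) ns" "1 < ns ! 0"
      using that k by (auto simp: stirling_chains_def)
    \<comment> \<open>The first step, from 1 to n_1, contributes a Stirling number equal to 1; this
      leaves k - 1 factors.\<close>
    have "N 1 (ns ! 0) = of_nat (Stirling (ns ! 0) 1)"
      using ns(3) by (rule N)
    then have "N 1 (ns ! 0) = 1"
      using ns(3) by (cases "ns ! 0") (simp_all del: Stirling.simps)
    moreover have "N (ns ! l) (ns ! Suc l) = of_nat (Stirling (ns ! Suc l) (ns ! l))" if "l < k'" for l
      using ns k that by (intro N) (auto simp: sorted_wrt_iff_nth_less)
    ultimately show ?thesis
      by (simp add: k prod.lessThan_Suc_shift del: prod.lessThan_Suc)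
  qed
  have upper_N: "strictly_upper N"
    unfolding N_def by (intro strictly_upper_iteration_matrix) simp_all
  show ?thesis
    unfolding mat_power_strict_chains[OF upper_N] stirling_chains_eq_strict_chains[OF assms(1), symmetric]
    by (intro sum.cong refl prod)
qed

subsection \<open>The coefficients of the logarithm\<close>

text \<open>An index path starting at a positive index never enters 0, so deleting the first row and
  column commutes with powers.\<close>

lemma mat_power_Suc_Suc:
  assumes "\<And>i. M (Suc i) 0 = 0"
  shows "mat_power M n (Suc i) (Suc j) = mat_power (\<lambda>i j. M (Suc i) (Suc j)) n i j"
proof (induction n arbitrary: i)
  case (Suc n)
  then show ?case
    by (simp add: mat_mult_def sum.atMost_Suc_shift assms del: sum.atMost_Suc)
qed (simp add: mat_one_def)

lemma mat_log_Suc_Suc: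
  assumes "\<And>i. M (Suc i) 0 = 0"
  shows "mat_log M (Suc i) (Suc j) = mat_log (\<lambda>i j. M (Suc i) (Suc j)) i j"
  by (simp add: mat_log_def mat_power_Suc_Suc assms mat_one_def)

theorem proposition7p1:
  fixes \<alpha> :: "nat \<Rightarrow> nat \<Rightarrow> rat" and h :: "rat fps" and c :: "nat \<Rightarrow> rat"
  assumes "\<And>f. L_op f = exp_op (l_op \<alpha>) f"
    and "h = itlog (fps_exp 1 - 1)"
    and "\<And>n. n \<ge> 1 \<Longrightarrow> c n = fact n * fps_nth h n"
  shows "(\<forall>i j. i < j \<longrightarrow> \<alpha> i j = c (j - i + 1) * of_nat ((j + 1) choose i)) \<and>
         (\<forall>n\<ge>1. c n = (\<Sum>k = 1..<n. \<Sum>ns \<in> stirling_chains n k.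
            (-1) ^ (k + 1) / of_nat k *
            (\<Prod>i<k - 1. of_nat (Stirling (ns ! (i + 1)) (ns ! i)))))"
proof (intro conjI allI impI)
  let ?M = "iteration_matrix (fps_exp 1 - 1)"
  have log: "mat_log ?M = inf_iteration_matrix h"
    unfolding assms(2) by (rule itlog) simp_all
  \<comment> \<open>For i < j this is the comparison of linear parts; on and below the diagonal both
    sides agree with the identity matrix.\<close>
  have exp: "mat_fps (fps_exp 1) (strict_part \<alpha>) = (\<lambda>i j. ?M (Suc i) (Suc j))"
  proof (intro ext)
    fix i j
    show "mat_fps (fps_exp 1) (strict_part \<alpha>) i j = ?M (Suc i) (Suc j)"
    proof (cases "i < j")
      case True
      then show ?thesis
        by (simp only: iteration_matrix_exp flip: a_coeff_eq_exp[OF assms(1)] a_coeff_eq_Stirling)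
    next
      case False
      moreover have "strictly_upper (mat_fps (fps_exp 1 - 1) (strict_part \<alpha>))"
        by (intro strictly_upper_mat_fps strictly_upper_strict_part) simp
      ultimately have "mat_fps (fps_exp 1) (strict_part \<alpha>) i j = mat_one i j"
        using strictly_upperD[of _ j i] by (fastforce simp: mat_fps_diff mat_fps_1)
      also have "\<dots> = ?M (Suc i) (Suc j)"
        using False by (auto simp: iteration_matrix_exp mat_one_def simp del: Stirling.simps)
      finally show ?thesis .
    qed
  qed
  {
    fix i j :: nat
    assume ij: "i < j"
    have "\<alpha> i j = mat_log (mat_fps (fps_exp 1) (strict_part \<alpha>)) i j"
      using ij by (simp add: mat_log_mat_fps_exp strictly_upper_strict_part strict_part_def)
    also have "\<dots> = mat_log ?M (Suc i) (Suc j)"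
      unfolding exp by (rule mat_log_Suc_Suc [symmetric]) (simp add: iteration_matrix_exp)
    also have "\<dots> = fact (j + 1) / fact i * fps_nth h (j - i + 1)"
      using ij by (simp add: log inf_iteration_matrix_def)
    \<comment> \<open>The factor (j - i + 1)! in c turns the quotient (j + 1)! / i! into a binomial
      coefficient.\<close>
    also have "\<dots> = c (j - i + 1) * of_nat ((j + 1) choose i)"
      using ij by (simp add: assms(3) binomial_fact Suc_diff_le del: fact_Suc)
    finally show "\<alpha> i j = c (j - i + 1) * of_nat ((j + 1) choose i)" .
  next
    fix n :: nat
    assume n: "1 \<le> n"
    let ?N = "\<lambda>i j. ?M i j - mat_one i j"
    have N: "strictly_upper ?N"
      by (intro strictly_upper_iteration_matrix) simp_all
    have "c n = mat_log ?M 1 n"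
      using n by (simp add: assms(3) log inf_iteration_matrix_def)
    also have "\<dots> = (\<Sum>k\<le>n. fps_nth (fps_ln 1) k * mat_power ?N k 1 n)"
      by (simp add: mat_log_eq_mat_fps[OF N] mat_fps_def)
    \<comment> \<open>The term k = 0 vanishes since ln(1 + X) has no constant term, and k = n since
      k steps up from 1 end at k + 1 or later.\<close>
    also have "\<dots> = (\<Sum>k=1..<n. fps_nth (fps_ln 1) k * mat_power ?N k 1 n)"
      by (rule sum.mono_neutral_right) (auto simp: mat_power_eq_0[OF N] fps_ln_nth)
    also have "\<dots> = (\<Sum>k=1..<n. \<Sum>ns\<in>stirling_chains n k. (-1) ^ (k + 1) / of_nat k *
        (\<Prod>i<k - 1. of_nat (Stirling (ns ! (i + 1)) (ns ! i))))"
    proof (intro sum.cong refl)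
      fix k assume k: "k \<in> {1..<n}"
      then have pos: "k > 0" by simp
      then have "fps_nth (fps_ln 1) k = (-1) ^ (k + 1) / (of_nat k :: rat)"
        by (cases k) (simp_all add: fps_ln_nth)
      then show "fps_nth (fps_ln 1) k * mat_power ?N k 1 n
          = (\<Sum>ns\<in>stirling_chains n k. (-1) ^ (k + 1) / of_nat k *
              (\<Prod>i<k - 1. of_nat (Stirling (ns ! (i + 1)) (ns ! i))))"
        by (simp only: mat_power_iteration_matrix_exp[OF pos] sum_distrib_left)
    qed
    finally show "c n = (\<Sum>k=1..<n. \<Sum>ns\<in>stirling_chains n k. (-1) ^ (k + 1) / of_nat k *
        (\<Prod>i<k - 1. of_nat (Stirling (ns ! (i + 1)) (ns ! i))))" .
  }
qed

end
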